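(* Let $A\in\mathbb{R}^{m\times n}$ have full row rank, $b\in\mathbb{R}^m$, $c\in\mathbb{R}^n$, and assume the linear program (LP) $\max\{c^Tx : Ax=b,\ x\in\mathbb{R}^n_+\}$ has finite optimal value. Suppose $R>0$ is given and the triplet $(w,y,z)=(w(R),y(R),z(R))$ is primal-dual optimal for $$\min_w\Big\{\tfrac12\|w-c\|^2 : Aw=\tfrac1R b,\ w\in\mathbb{R}^n_+\Big\},$$ i.e. $w-c-A^Ty-z=0$, $Aw=\tfrac1R b$, $z^Tw=0$, $w,z\in\mathbb{R}^n_+$, $y\in\mathbb{R}^m$. Let $$\mathcal{N}=\{i : z_i>0\},\quad \mathcal{B}=\{i : w_i>0\},\quad \mathcal{Z}=\{i : w_i=z_i=0\},$$ let $$\Delta y_p:=V_{\mathcal{Z}}\big(A_{\mathcal{B}}A_{\mathcal{B}}^TV_{\mathcal{Z}}\big)^\dagger b,\qquad b_{\mathcal{B}}:=A_{\mathcal{B}}^T\Delta y_p,\qquad b_{\mathcal{N}}:=A_{\mathcal{N}}^T\Delta y_p,$$ and let $$e=\begin{pmatrix}b_{\mathcal{B}}-Rw_{\mathcal{B}}\\ -(b_{\mathcal{N}}+Rz_{\mathcal{N}})\end{pmatrix},\qquad f=\begin{pmatrix}Rb_{\mathcal{B}}\\ -Rb_{\mathcal{N}}\end{pmatrix}.$$ Then the maximum value to which $R$ can be increased while maintaining both optimality and the indices in the bases sets $\mathcal{B},\mathcal{N},\mathcal{Z}$ is $$R_n=\min\{f_i/e_i : e_i>0,\ f_i>0\},$$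 where the minimum over the empty set is $+\infty$. When $R_n<\infty$, the corresponding changes $$\Delta y=\frac{R-R_n}{RR_n}\,\Delta y_p,\qquad \Delta w_{\mathcal{B}}=-\frac{R_n-R}{RR_n}\,b_{\mathcal{B}},\qquad \Delta z_{\mathcal{N}}=\frac{R_n-R}{RR_n}\,b_{\mathcal{N}},$$ with all other components of $\Delta w$ and $\Delta z$ equal to $0$, result in a triplet $(w+\Delta w,\,y+\Delta y,\,z+\Delta z)$ that is still optimal for the problem with $R$ replaced by $R_n$. Moreover, if $R_n=\infty$, then the optimal solution of the LP has been found, i.e. $x=Rw$ is an optimal solution of the LP.
   Context: $\mathbb{R}^n_+$ is the nonnegative orthant. For an index set $\mathcal{T}$, $A_{\mathcal{T}}$ denotes the submatrix of $A$ formed by the columns indexed by $\mathcal{T}$, and $w_{\mathcal{T}}$, $z_{\mathcal T}$ the corresponding subvectors. $M^\dagger$ is the Moore-Penrose generalized inverse of $M$. If $\mathcal{Z}\ne\varnothing$ (strict complementarity fails), $V_{\mathcal{Z}}$ is a chosen full column rank matrix with $\operatorname{range}(V_{\mathcal{Z}})=\operatorname{null}(A_{\mathcal{Z}}^T)$; otherwise $V_{\mathcal{Z}}=I$. "Maintaining both optimality and the indices in the bases sets" at a parameter value $R'\ge R$ means: the triplet $(w+\Delta w,y+\Delta y,z+\Delta z)$, with the changes given by the displayed formulas with $R_n$ replaced by $R'$, satisfies the optimality conditions for the problem with right-hand side $\tfrac1{R'}b$, with $w_i+\Delta w_i\ge0$ for $i\in\mathcal{B}$, $z_i+\Delta z_i\ge0$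 for $i\in\mathcal{N}$, $w_i+\Delta w_i=0$ for $i\notin\mathcal B$, $z_i+\Delta z_i=0$ for $i\notin\mathcal N$. If $R_n=\infty$ this is to be read as holding for all $R'\ge R$. The LP solution associated with the triplet at parameter $R$ is $x(R)=Rw(R)$.
   Formalization: When $\mathcal{Z}\neq\varnothing$, it is additionally assumed that $b$ lies in the range of $A_{\mathcal{B}}A_{\mathcal{B}}^TV_{\mathcal{Z}}$; otherwise no $R'>R$ is feasible although the formula gives $R_n>R$, so the claim is false. *)

theory Defs
  imports
    "HOL-Library.Extended_Real"
    "Jordan_Normal_Form.DL_Rank"
    "Jordan_Normal_Form.DL_Submatrix"
    "Jordan_Normal_Form.Matrix_Kernel"
begin

text \<open>
  All vectors and matrices are those of Jordan-Normal-Form: dimensions are natural numbers,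
  indices start at 0, and a matrix may have no rows or no columns.
\<close>

abbreviation col_submatrix :: "real mat \<Rightarrow> nat set \<Rightarrow> real mat" where
  "col_submatrix A T \<equiv> submatrix A UNIV T"

text \<open>
  Entries of a subvector appear in increasing order of their indices, as in \<^const>\<open>submatrix\<close>:
  \<^term>\<open>pick T j\<close> is the \<open>j\<close>-th smallest element of \<open>T\<close>, and the position of \<open>i \<in> T\<close>
  in the subvector is the number of elements of \<open>T\<close> below \<open>i\<close>.
\<close>

definition subvec :: "real vec \<Rightarrow> nat set \<Rightarrow> real vec" where
  "subvec v T = Matrix.vec (card {i. i < dim_vec v \<and> i \<in> T}) (\<lambda>j. v $ pick T j)"

definition extend_zero :: "nat \<Rightarrow> nat set \<Rightarrow> real vec \<Rightarrow> real vec" where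
  "extend_zero n T u = Matrix.vec n (\<lambda>i. if i \<in> T then u $ card {j \<in> T. j < i} else 0)"

lemma subvec_extend_zero:
  assumes "T \<subseteq> {..<n}" "u \<in> carrier_vec (card T)"
  shows "subvec (extend_zero n T u) T = u"
proof (rule eq_vecI)
  have T: "{i. i < n \<and> i \<in> T} = T" using assms(1) by auto
  show "dim_vec (subvec (extend_zero n T u) T) = dim_vec u"
    using assms(2) by (simp add: subvec_def extend_zero_def T)
  fix j assume "j < dim_vec u"
  then have j: "j < card T" using assms(2) by simp
  have fin: "finite T" using assms(1) finite_subset by blast
  have p: "pick T j \<in> T" using pick_in_set_le[OF j] .
  then have "pick T j < n" using assms(1) by auto
  then show "subvec (extend_zero n T u) T $ j = u $ j"
    using p j card_pick_le[OF j] by (simp add: subvec_def extend_zero_def T)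
qed

text \<open>The four Penrose equations; over the reals the adjoint is the transpose.\<close>

definition is_moore_penrose :: "real mat \<Rightarrow> real mat \<Rightarrow> bool" where
  "is_moore_penrose M X \<longleftrightarrow>
     X \<in> carrier_mat (dim_col M) (dim_row M) \<and>
     M * X * M = M \<and> X * M * X = X \<and>
     transpose_mat (M * X) = M * X \<and> transpose_mat (X * M) = X * M"

definition moore_penrose :: "real mat \<Rightarrow> real mat" where
  "moore_penrose M = (THE X. is_moore_penrose M X)"

definition lp_feasible :: "real mat \<Rightarrow> real vec \<Rightarrow> real vec set" where
  "lp_feasible A b = {x \<in> carrier_vec (dim_col A). A *\<^sub>v x = b \<and> 0\<^sub>v (dim_col A) \<le> x}"

text \<open>The value is \<open>-\<infinity>\<close> for an infeasible and \<open>\<infinity>\<close> for an unbounded program.\<close>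

definition lp_value :: "real mat \<Rightarrow> real vec \<Rightarrow> real vec \<Rightarrow> ereal" where
  "lp_value A b c = (SUP x \<in> lp_feasible A b. ereal (c \<bullet> x))"

definition lp_optimal :: "real mat \<Rightarrow> real vec \<Rightarrow> real vec \<Rightarrow> real vec \<Rightarrow> bool" where
  "lp_optimal A b c x \<longleftrightarrow> x \<in> lp_feasible A b \<and> (\<forall>x' \<in> lp_feasible A b. c \<bullet> x' \<le> c \<bullet> x)"

text \<open>
  Primal-dual optimality (the optimality conditions) for
  minimising \<open>\<parallel>w - c\<parallel>\<^sup>2 / 2\<close> over \<open>A w = d\<close>, \<open>w \<ge> 0\<close>.
\<close>

definition optimal_triplet ::
    "real mat \<Rightarrow> real vec \<Rightarrow> real vec \<Rightarrow> real vec \<Rightarrow> real vec \<Rightarrow> real vec \<Rightarrow> bool" where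
  "optimal_triplet A d c w y z \<longleftrightarrow>
     w \<in> carrier_vec (dim_col A) \<and> y \<in> carrier_vec (dim_row A) \<and> z \<in> carrier_vec (dim_col A) \<and>
     w - c - transpose_mat A *\<^sub>v y - z = 0\<^sub>v (dim_col A) \<and>
     A *\<^sub>v w = d \<and> z \<bullet> w = 0 \<and>
     0\<^sub>v (dim_col A) \<le> w \<and> 0\<^sub>v (dim_col A) \<le> z"

text \<open>For \<open>Z \<noteq> {}\<close>: full column rank, and range equal to the null space of \<open>A\<^sub>Z\<^sup>T\<close>; \<open>V\<close> may have no columns.\<close>

definition admissible_V :: "real mat \<Rightarrow> nat set \<Rightarrow> real mat \<Rightarrow> bool" where
  "admissible_V A Z V \<longleftrightarrow>
     (if Z = {} then V = 1\<^sub>m (dim_row A)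
      else dim_row V = dim_row A \<and>
           vec_space.rank (dim_row V) V = dim_col V \<and>
           vec_space.col_space (dim_row V) V = mat_kernel (transpose_mat (col_submatrix A Z)))"

definition step_matrix :: "real mat \<Rightarrow> nat set \<Rightarrow> real mat \<Rightarrow> real mat" where
  "step_matrix A B V = col_submatrix A B * transpose_mat (col_submatrix A B) * V"

text \<open>
  \<open>dy_p\<close> is meant to solve \<open>A\<^sub>B A\<^sub>B\<^sup>T p = b\<close> within the range of \<open>V\<close>. This system is solvable if
  \<open>Z = {}\<close>, but need not be otherwise, and then \<open>dy_p\<close> only yields a least squares solution:
  for \<open>A = (1 1 1)\<close>, \<open>b = 3\<close>, \<open>c = w = (2, 1, 0)\<close>, \<open>y = 0\<close>, \<open>z = 0\<close>, \<open>R = 1\<close> the matrix \<open>V\<close> has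
  no columns, \<open>dy_p = 0\<close>, the minimal ratio is \<open>\<infinity>\<close>, and yet \<open>R w\<close> is not optimal for the linear
  program. Hence solvability is a hypothesis of the theorem when \<open>Z \<noteq> {}\<close>.
\<close>

definition dy_p :: "real mat \<Rightarrow> nat set \<Rightarrow> real mat \<Rightarrow> real vec \<Rightarrow> real vec" where
  "dy_p A B V b = V *\<^sub>v (moore_penrose (step_matrix A B V) *\<^sub>v b)"

text \<open>
  The changes when the parameter goes from \<open>R\<close> to \<open>R'\<close>; \<open>p\<close> stands for \<^const>\<open>dy_p\<close>,
  and \<open>u\<close> for \<open>A\<^sub>B\<^sup>T p\<close> respectively \<open>A\<^sub>N\<^sup>T p\<close>.
\<close>

definition delta_y :: "real \<Rightarrow> real \<Rightarrow> real vec \<Rightarrow> real vec" where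
  "delta_y R R' p = ((R - R') / (R * R')) \<cdot>\<^sub>v p"

definition delta_w :: "nat \<Rightarrow> nat set \<Rightarrow> real \<Rightarrow> real \<Rightarrow> real vec \<Rightarrow> real vec" where
  "delta_w n B R R' u = extend_zero n B ((- ((R' - R) / (R * R'))) \<cdot>\<^sub>v u)"

definition delta_z :: "nat \<Rightarrow> nat set \<Rightarrow> real \<Rightarrow> real \<Rightarrow> real vec \<Rightarrow> real vec" where
  "delta_z n N R R' u = extend_zero n N (((R' - R) / (R * R')) \<cdot>\<^sub>v u)"

definition maintained ::
    "real mat \<Rightarrow> real vec \<Rightarrow> real vec \<Rightarrow> nat set \<Rightarrow> nat set \<Rightarrow> real vec \<Rightarrow>
     real \<Rightarrow> real vec \<Rightarrow> real vec \<Rightarrow> real vec \<Rightarrow> real \<Rightarrow> bool" where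
  "maintained A b c B N p R w y z R' \<longleftrightarrow>
     (let n = dim_col A;
          w' = w + delta_w n B R R' (transpose_mat (col_submatrix A B) *\<^sub>v p);
          y' = y + delta_y R R' p;
          z' = z + delta_z n N R R' (transpose_mat (col_submatrix A N) *\<^sub>v p)
      in optimal_triplet A ((1 / R') \<cdot>\<^sub>v b) c w' y' z' \<and>
         (\<forall>i<n. (i \<in> B \<longrightarrow> w' $ i \<ge> 0) \<and> (i \<notin> B \<longrightarrow> w' $ i = 0)) \<and>
         (\<forall>i<n. (i \<in> N \<longrightarrow> z' $ i \<ge> 0) \<and> (i \<notin> N \<longrightarrow> z' $ i = 0)))"

text \<open>The infimum of a finite nonempty set is its minimum; the infimum of the empty set is \<open>\<infinity>\<close>.\<close>

definition ratio_min :: "real vec \<Rightarrow> real vec \<Rightarrow> ereal" where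
  "ratio_min e f = (INF i \<in> {i. i < dim_vec e \<and> e $ i > 0 \<and> f $ i > 0}. ereal (f $ i / e $ i))"

end

theory Submission
  imports Defs
begin

text \<open>
  The direction \<open>p\<close> solves \<open>A\<^sub>B A\<^sub>B\<^sup>T p = b\<close> with \<open>A\<^sub>Z\<^sup>T p = 0\<close>. With \<open>q = A\<^sup>T p\<close> and
  \<open>t = 1 / R - 1 / R'\<close>, the triplet \<open>w - t q\<^sub>B, y - t p, z + t q\<^sub>N\<close> satisfies all equations of the
  optimality conditions for the right-hand side \<open>b / R'\<close>, so only the signs on \<open>B\<close> and \<open>N\<close> matter;
  multiplied by \<open>R R'\<close> they read \<open>R' e \<le> f\<close>. Since \<open>R e < f\<close>, only the entries with \<open>e > 0\<close>
  bind, which gives the ratio test.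
  If no entry binds, the limit \<open>t = 1 / R\<close> gives a triplet for the right-hand side \<open>0\<close>, whose dual
  part certifies the optimality of \<open>R w\<close>.
\<close>

section \<open>Gram matrices and the Moore-Penrose inverse\<close>

lemma scalar_prod_self_eq_0:
  fixes v :: "real vec"
  assumes "v \<in> carrier_vec n"
  shows "v \<bullet> v = 0 \<longleftrightarrow> v = 0\<^sub>v n"
  using assms by (auto simp: scalar_prod_def sum_nonneg_eq_0_iff intro!: eq_vecI)

text \<open>The squared length of \<open>M *\<^sub>v v\<close> is the scalar product of
  \<open>M\<^sup>T *\<^sub>v (M *\<^sub>v v)\<close> with \<open>v\<close>.\<close>

lemma gram_mult_vec_eq_0:
  fixes M :: "real mat"
  assumes M: "M \<in> carrier_mat m n" and v: "v \<in> carrier_vec n" and "M\<^sup>T *\<^sub>v (M *\<^sub>v v) = 0\<^sub>v n"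
  shows "M *\<^sub>v v = 0\<^sub>v m"
proof -
  have "(M *\<^sub>v v) \<bullet> (M *\<^sub>v v) = (M\<^sup>T *\<^sub>v (M *\<^sub>v v)) \<bullet> v"
    using transpose_vec_mult_scalar[OF M v, of "M *\<^sub>v v"] M v by simp
  then show ?thesis using assms scalar_prod_self_eq_0[of "M *\<^sub>v v" m] by simp
qed

text \<open>
  The inner inverse is corrected one column \<open>a\<close> at a time by a rank one update \<open>d h\<^sup>T\<close>, where \<open>h\<close>
  vanishes on the earlier columns and \<open>h \<bullet> a = 1\<close>.
\<close>

lemma exists_inner_inverse:
  fixes A :: "'a::field mat"
  assumes A: "A \<in> carrier_mat m n"
  shows "\<exists>G \<in> carrier_mat n m. A * G * A = A"
proof -
  have "\<exists>G \<in> carrier_mat n m. \<forall>j<k. A *\<^sub>v (G *\<^sub>v col A j) = col A j" if "k \<le> n" for k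
    using that
  proof (induction k)
    case 0
    have "0\<^sub>m n m \<in> carrier_mat n m" by simp
    then show ?case by blast
  next
    case (Suc k)
    then obtain G where G: "G \<in> carrier_mat n m"
      and IH: "\<And>j. j < k \<Longrightarrow> A *\<^sub>v (G *\<^sub>v col A j) = col A j" by auto
    define a where "a = col A k"
    have a: "a \<in> carrier_vec m" using A unfolding a_def by auto
    show ?case
    proof (cases "A *\<^sub>v (G *\<^sub>v a) = a")
      case True
      then show ?thesis using G IH unfolding a_def by (metis less_antisym)
    next
      case False
      then obtain i where i: "i < m" "a $ i \<noteq> (A *\<^sub>v (G *\<^sub>v a)) $ i"
        using A G a by (metis eq_vecI carrier_vecD carrier_matD(1) dim_mult_mat_vec)
      \<comment> \<open>\<open>t\<close> reads off a coordinate at which \<open>a\<close> and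
        \<open>A G a\<close> differ, scaled so that its product with the residual
        \<open>a - A G a\<close> is 1.\<close>
      define t where "t = (1 / (a $ i - (A *\<^sub>v (G *\<^sub>v a)) $ i)) \<cdot>\<^sub>v unit_vec m i"
      have t: "t \<in> carrier_vec m" by (simp add: t_def)
      \<comment> \<open>Moving \<open>A G\<close> to the other side makes \<open>h\<close> test the
        residual \<open>x - A G x\<close> of any \<open>x\<close>. It therefore vanishes on the
        columns that \<open>A G\<close> already fixes.\<close>
      define h where "h = t - (A * G)\<^sup>T *\<^sub>v t"
      have h: "h \<in> carrier_vec m" unfolding h_def using t A G by (intro minus_carrier_vec mult_mat_vec_carrier[of _ m m]) auto
      have h_prod: "h \<bullet> x = t \<bullet> (x - A *\<^sub>v (G *\<^sub>v x))" if x: "x \<in> carrier_vec m" for x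
      proof -
        have "((A * G)\<^sup>T *\<^sub>v t) \<bullet> x = t \<bullet> (A *\<^sub>v (G *\<^sub>v x))"
          using transpose_vec_mult_scalar[of "A * G" m m x t] A G x t by simp
        moreover have "(A * G)\<^sup>T *\<^sub>v t \<in> carrier_vec m"
          using A t by (intro mult_mat_vec_carrier[of _ m m]) (auto simp: G)
        moreover have "A *\<^sub>v (G *\<^sub>v x) \<in> carrier_vec m"
          using A G x by (intro mult_mat_vec_carrier[of _ m n] mult_mat_vec_carrier[of _ n m])
        ultimately show ?thesis
          unfolding h_def using t x
          by (simp add: minus_scalar_prod_distrib[of _ m] scalar_prod_minus_distrib[of _ m])
      qed
      have ha: "h \<bullet> a = 1"
        unfolding h_prod[OF a] t_def using A G a i by (simp add: scalar_prod_left_unit[of _ m])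
      have h0: "h \<bullet> col A j = 0" if "j < k" for j
      proof -
        have Aj: "col A j \<in> carrier_vec m" using A by auto
        then show ?thesis using h_prod[OF Aj] IH[OF that] t by simp
      qed
      \<comment> \<open>Since \<open>h \<bullet> a = 1\<close>, this choice gives
        \<open>H a = G a + d\<close>, the \<open>k\<close>-th unit vector, which \<open>A\<close>
        maps back to its column \<open>a\<close>.\<close>
      define d where "d = unit_vec n k - G *\<^sub>v a"
      have d: "d \<in> carrier_vec n" unfolding d_def using G a by (intro minus_carrier_vec mult_mat_vec_carrier[of _ n m]) auto
      define H where "H = G + Matrix.mat n m (\<lambda>(i,l). d $ i * h $ l)"
      have H: "H \<in> carrier_mat n m" using G by (simp add: H_def)
      have H_mult: "H *\<^sub>v x = G *\<^sub>v x + (h \<bullet> x) \<cdot>\<^sub>v d" if x: "x \<in> carrier_vec m" for x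
      proof -
        have "Matrix.mat n m (\<lambda>(i,l). d $ i * h $ l) *\<^sub>v x = (h \<bullet> x) \<cdot>\<^sub>v d"
          using x h d by (intro eq_vecI) (auto simp: scalar_prod_def sum_distrib_left mult_ac)
        then show ?thesis
          unfolding H_def using G x by (subst add_mult_distrib_mat_vec[of _ n m]) auto
      qed
      have "A *\<^sub>v (H *\<^sub>v col A j) = col A j" if "j < Suc k" for j
      proof (cases "j = k")
        case True
        have "H *\<^sub>v a = unit_vec n k"
          unfolding H_mult[OF a] ha d_def using G a by (intro eq_vecI) auto
        moreover have "A *\<^sub>v unit_vec n k = a"
          unfolding a_def using A Suc.prems by (intro eq_vecI) auto
        ultimately show ?thesis using True by (simp add: a_def)
      next
        case False
        then have "j < k" using that by simp
        have "col A j \<in> carrier_vec m" using A by auto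
        then have "H *\<^sub>v col A j = G *\<^sub>v col A j"
          unfolding H_mult[OF \<open>col A j \<in> carrier_vec m\<close>] h0[OF \<open>j < k\<close>]
          using G d by (intro eq_vecI) auto
        then show ?thesis using IH \<open>j < k\<close> by simp
      qed
      then show ?thesis using H by blast
    qed
  qed
  from this[of n] obtain G where G: "G \<in> carrier_mat n m"
    and "\<And>j. j < n \<Longrightarrow> A *\<^sub>v (G *\<^sub>v col A j) = col A j" by auto
  moreover have "col (A * G * A) j = A *\<^sub>v (G *\<^sub>v col A j)" if "j < n" for j
  proof -
    have "col A j \<in> carrier_vec m" using A by auto
    then show ?thesis
      using col_mult2[OF mult_carrier_mat[OF A G] A that] assoc_mult_mat_vec[OF A G] by simp
  qed
  ultimately have "A * G * A = A" using A by (intro mat_col_eqI) auto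
  then show ?thesis using G by blast
qed

text \<open>A difference \<open>v\<close> of corresponding columns of \<open>K\<close> and
  \<open>L\<close> satisfies \<open>M\<^sup>T M v = 0\<close>, hence already
  \<open>M v = 0\<close>.\<close>

lemma gram_mult_cancel:
  fixes M K L :: "real mat"
  assumes M: "M \<in> carrier_mat m n" and K: "K \<in> carrier_mat n k" and L: "L \<in> carrier_mat n k"
    and eq: "M\<^sup>T * (M * K) = M\<^sup>T * (M * L)"
  shows "M * K = M * L"
proof (rule mat_col_eqI)
  fix j assume "j < dim_col (M * L)"
  then have j: "j < k" using L by simp
  define v where "v = col K j - col L j"
  have v: "v \<in> carrier_vec n" and cK: "col K j \<in> carrier_vec n" and cL: "col L j \<in> carrier_vec n"
    using K L unfolding v_def by (auto intro!: minus_carrier_vec)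
  have mult_col_K: "col (M * K) j = M *\<^sub>v col K j" and mult_col_L: "col (M * L) j = M *\<^sub>v col L j"
    using col_mult2[OF M K j] col_mult2[OF M L j] by auto
  have Mv: "M *\<^sub>v v = M *\<^sub>v col K j - M *\<^sub>v col L j"
    unfolding v_def by (rule mult_minus_distrib_mat_vec[OF M cK cL])
  have "M\<^sup>T *\<^sub>v (M *\<^sub>v col K j) = M\<^sup>T *\<^sub>v (M *\<^sub>v col L j)"
    using col_mult2[of "M\<^sup>T" n m "M * K" k j] col_mult2[of "M\<^sup>T" n m "M * L" k j] M K L j eq mult_col_K mult_col_L
    by simp
  then have "M\<^sup>T *\<^sub>v (M *\<^sub>v v) = 0\<^sub>v n"
    unfolding Mv using M cK cL by (subst mult_minus_distrib_mat_vec[of _ n m]) auto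
  then have "M *\<^sub>v v = 0\<^sub>v m" by (rule gram_mult_vec_eq_0[OF M v])
  then have d: "M *\<^sub>v col K j - M *\<^sub>v col L j = 0\<^sub>v m" by (simp add: Mv)
  have "M *\<^sub>v col K j = M *\<^sub>v col L j"
  proof (rule eq_vecI)
    fix i assume "i < dim_vec (M *\<^sub>v col L j)"
    then show "(M *\<^sub>v col K j) $ i = (M *\<^sub>v col L j) $ i"
      using arg_cong[OF d, of "\<lambda>u. u $ i"] M by simp
  qed simp
  then show "col (M * K) j = col (M * L) j" by (simp add: mult_col_K mult_col_L)
qed (use M K L in auto)

text \<open>Any inner inverse of \<open>M\<^sup>T M\<close> serves as \<open>H\<close>.\<close>

lemma exists_least_squares_inverse:
  fixes M :: "real mat"
  assumes M: "M \<in> carrier_mat m n"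
  shows "\<exists>H \<in> carrier_mat n n. M * (H * M\<^sup>T) * M = M \<and> (M * (H * M\<^sup>T))\<^sup>T = M * (H * M\<^sup>T)"
proof -
  obtain G where G: "G \<in> carrier_mat n n" and inner: "M\<^sup>T * M * G * (M\<^sup>T * M) = M\<^sup>T * M"
    using exists_inner_inverse[of "M\<^sup>T * M" n n] M by auto
  define X where "X = G * M\<^sup>T"
  have MT: "M\<^sup>T \<in> carrier_mat n m" using M by simp
  have X: "X \<in> carrier_mat n m" unfolding X_def using G MT by (rule mult_carrier_mat)
  have MM: "M\<^sup>T * M \<in> carrier_mat n n" using MT M by (rule mult_carrier_mat)
  have GMM: "G * (M\<^sup>T * M) \<in> carrier_mat n n" using G MM by (rule mult_carrier_mat)
  have MX: "M * X \<in> carrier_mat m m" using M X by (rule mult_carrier_mat)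
  have "M\<^sup>T * (M * (G * (M\<^sup>T * M))) = M\<^sup>T * (M * 1\<^sub>m n)"
    using inner assoc_mult_mat[OF MM G MM] assoc_mult_mat[OF MT M GMM] M by simp
  then have "M * (G * (M\<^sup>T * M)) = M * 1\<^sub>m n"
    by (rule gram_mult_cancel[OF M GMM one_carrier_mat])
  then have 1: "M * X * M = M"
    using assoc_mult_mat[OF M X M] assoc_mult_mat[OF G MT M] M by (simp add: X_def)
  \<comment> \<open>Transposing \<open>M X M = M\<close> allows a factor
    \<open>(M X)\<^sup>T\<close> to be inserted after the trailing \<open>M\<^sup>T\<close> of
    \<open>X\<close>. This exhibits \<open>M X\<close> as \<open>M X (M X)\<^sup>T\<close>, which is
    symmetric.\<close>
  have "M\<^sup>T * (M * X)\<^sup>T = M\<^sup>T"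
    using arg_cong[OF 1, of transpose_mat] transpose_mult[OF MX M] by simp
  then have "M * X = M * (G * (M\<^sup>T * (M * X)\<^sup>T))" by (simp add: X_def)
  also have "\<dots> = M * X * (M * X)\<^sup>T"
    using assoc_mult_mat[OF M X, of "(M * X)\<^sup>T" m] assoc_mult_mat[OF G MT, of "(M * X)\<^sup>T" m] MX
    by (simp add: X_def)
  finally have P: "M * X = M * X * (M * X)\<^sup>T" .
  have "(M * X)\<^sup>T = M * X"
    using arg_cong[OF P, of transpose_mat] transpose_mult[OF MX, of "(M * X)\<^sup>T" m] MX P by simp
  with 1 show ?thesis using G by (auto simp: X_def)
qed

text \<open>The least squares inverse \<open>Y\<close> of \<open>M\<close> makes \<open>M Y\<close>
  symmetric, and the transpose \<open>Z\<close> of the one for \<open>M\<^sup>T\<close> makes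
  \<open>Z M\<close> symmetric. The product \<open>X = Z M Y\<close> inherits both properties,
  because \<open>M X = M Y\<close> and \<open>X M = Z M\<close>.\<close>

lemma exists_moore_penrose:
  assumes M: "M \<in> carrier_mat m n"
  shows "\<exists>X. is_moore_penrose M X"
proof -
  have MT: "M\<^sup>T \<in> carrier_mat n m" using M by simp
  obtain H where H: "H \<in> carrier_mat n n"
    and "M * (H * M\<^sup>T) * M = M" "(M * (H * M\<^sup>T))\<^sup>T = M * (H * M\<^sup>T)"
    using exists_least_squares_inverse[OF M] by auto
  with mult_carrier_mat[OF H MT] obtain Y
    where Y: "Y \<in> carrier_mat n m" "M * Y * M = M" "(M * Y)\<^sup>T = M * Y" by blast
  obtain K where K: "K \<in> carrier_mat m m"
    and "M\<^sup>T * (K * M) * M\<^sup>T = M\<^sup>T" "(M\<^sup>T * (K * M))\<^sup>T = M\<^sup>T * (K * M)"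
    using exists_least_squares_inverse[OF MT] by auto
  with mult_carrier_mat[OF K M] obtain W
    where W: "W \<in> carrier_mat m n" "M\<^sup>T * W * M\<^sup>T = M\<^sup>T" "(M\<^sup>T * W)\<^sup>T = M\<^sup>T * W" by blast
  define Z where "Z = W\<^sup>T"
  have Z: "Z \<in> carrier_mat n m" using W by (simp add: Z_def)
  have ZM: "(M\<^sup>T * W)\<^sup>T = Z * M" using transpose_mult[OF MT W(1)] by (simp add: Z_def)
  have Zs: "(Z * M)\<^sup>T = Z * M" using W(3) ZM by simp
  have "(M\<^sup>T * W * M\<^sup>T)\<^sup>T = M * (Z * M)"
    using transpose_mult[of "M\<^sup>T * W" n n "M\<^sup>T" m] ZM MT W by simp
  then have Zi: "M * (Z * M) = M" using W(2) by simp
  define X where "X = Z * (M * Y)"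
  have MY: "M * Y \<in> carrier_mat m m" using M Y(1) by (rule mult_carrier_mat)
  have ZM_carrier: "Z * M \<in> carrier_mat n n" using Z M by (rule mult_carrier_mat)
  have X: "X \<in> carrier_mat n m" unfolding X_def using Z MY by (rule mult_carrier_mat)
  have MX: "M * X = M * Y"
  proof -
    have "M * X = M * (Z * M) * Y"
      using assoc_mult_mat[OF M ZM_carrier Y(1)] assoc_mult_mat[OF Z M Y(1)] by (simp add: X_def)
    then show ?thesis by (simp add: Zi)
  qed
  have XM: "X * M = Z * M"
    unfolding X_def using assoc_mult_mat[OF Z MY M] Y(2) by simp
  have "X * M * X = Z * (M * X)" unfolding XM using Z M X by (rule assoc_mult_mat)
  then have "X * M * X = X" by (simp only: MX X_def[symmetric])
  then show ?thesis
    using X M MX XM Y Zs by (intro exI[of _ X]) (auto simp: is_moore_penrose_def)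
qed

text \<open>\<open>M X\<close> and \<open>M Y\<close> are both the orthogonal projection onto the
  range of \<open>M\<close>: each absorbs the other, and transposing reverses the order of the
  product. The same holds for \<open>X M\<close> and \<open>Y M\<close>, so
  \<open>X = X M X = Y M X = Y M Y = Y\<close>.\<close>

lemma moore_penrose_unique:
  assumes X: "is_moore_penrose M X" and Y: "is_moore_penrose M Y"
  shows "X = Y"
proof -
  obtain m n where M: "M \<in> carrier_mat m n" by blast
  have cX: "X \<in> carrier_mat n m" and cY: "Y \<in> carrier_mat n m"
    using X Y M by (auto simp: is_moore_penrose_def)
  have left: "M * U = M * V" if U: "is_moore_penrose M U" and V: "is_moore_penrose M V"
    and c: "U \<in> carrier_mat n m" "V \<in> carrier_mat n m" for U V
  proof -
    have "M * U = M * V * M * U" using V by (simp add: is_moore_penrose_def)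
    also have "\<dots> = M * V * (M * U)" using M c by (intro assoc_mult_mat) auto
    also have "\<dots> = (M * V)\<^sup>T * (M * U)\<^sup>T" using U V by (simp add: is_moore_penrose_def)
    also have "\<dots> = (M * U * (M * V))\<^sup>T" using M c by (intro transpose_mult[symmetric]) auto
    also have "M * U * (M * V) = M * U * M * V" using M c by (intro assoc_mult_mat[symmetric]) auto
    also have "\<dots> = M * V" using U by (simp add: is_moore_penrose_def)
    also have "(M * V)\<^sup>T = M * V" using V by (simp add: is_moore_penrose_def)
    finally show ?thesis .
  qed
  have right: "U * M = V * M" if U: "is_moore_penrose M U" and V: "is_moore_penrose M V"
    and c: "U \<in> carrier_mat n m" "V \<in> carrier_mat n m" for U V
  proof -
    have "U * M = U * (M * V * M)" using V by (simp add: is_moore_penrose_def)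
    also have "\<dots> = U * (M * (V * M))" using assoc_mult_mat[OF M c(2) M] by simp
    also have "\<dots> = U * M * (V * M)" using M c by (intro assoc_mult_mat[symmetric]) auto
    also have "\<dots> = (U * M)\<^sup>T * (V * M)\<^sup>T" using U V by (simp add: is_moore_penrose_def)
    also have "\<dots> = (V * M * (U * M))\<^sup>T" using M c by (intro transpose_mult[symmetric]) auto
    also have "V * M * (U * M) = V * (M * (U * M))" using M c by (intro assoc_mult_mat) auto
    also have "\<dots> = V * (M * U * M)" using assoc_mult_mat[OF M c(1) M] by simp
    also have "\<dots> = V * M" using U by (simp add: is_moore_penrose_def)
    also have "(V * M)\<^sup>T = V * M" using V by (simp add: is_moore_penrose_def)
    finally show ?thesis .
  qed
  have "X = X * M * X" using X by (simp add: is_moore_penrose_def)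
  also have "\<dots> = Y * M * X" using right[OF X Y cX cY] by simp
  also have "\<dots> = Y * (M * X)" using cY M cX by (rule assoc_mult_mat)
  also have "\<dots> = Y * (M * Y)" using left[OF X Y cX cY] by simp
  also have "\<dots> = Y * M * Y" using assoc_mult_mat[OF cY M cY] by simp
  also have "\<dots> = Y" using Y by (simp add: is_moore_penrose_def)
  finally show ?thesis .
qed

lemma is_moore_penrose_moore_penrose: "is_moore_penrose M (moore_penrose M)"
proof -
  obtain X where X: "is_moore_penrose M X"
    using exists_moore_penrose[of M "dim_row M" "dim_col M"] by auto
  show ?thesis
    unfolding moore_penrose_def by (rule theI[of _ X]) (use X moore_penrose_unique in auto)
qed

text \<open>For a solvable system the pseudoinverse yields an exact solution and not merely a least
  squares one. This is what makes \<open>dy_p\<close> a usable direction.\<close>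

lemma moore_penrose_solves:
  assumes M: "M \<in> carrier_mat m n" and u: "u \<in> carrier_vec n"
  shows "M *\<^sub>v (moore_penrose M *\<^sub>v (M *\<^sub>v u)) = M *\<^sub>v u"
proof -
  have X: "moore_penrose M \<in> carrier_mat n m" and MXM: "M * moore_penrose M * M = M"
    using is_moore_penrose_moore_penrose[of M] M by (auto simp: is_moore_penrose_def)
  have MX: "M * moore_penrose M \<in> carrier_mat m m" using M X by (rule mult_carrier_mat)
  have Mu: "M *\<^sub>v u \<in> carrier_vec m" using M u by (rule mult_mat_vec_carrier)
  have "M *\<^sub>v (moore_penrose M *\<^sub>v (M *\<^sub>v u)) = (M * moore_penrose M) *\<^sub>v (M *\<^sub>v u)"
    using M X Mu by (rule assoc_mult_mat_vec[symmetric])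
  also have "\<dots> = (M * moore_penrose M * M) *\<^sub>v u"
    using MX M u by (rule assoc_mult_mat_vec[symmetric])
  finally show ?thesis by (simp only: MXM)
qed

text \<open>\<open>C\<^sup>T H C\<close> is the orthogonal projection onto the range of
  \<open>C\<^sup>T\<close>, and \<open>C\<close> does not distinguish \<open>u\<close> from its
  projection \<open>C\<^sup>T v\<close>.\<close>

lemma range_subset_range_gram:
  fixes C :: "real mat"
  assumes C: "C \<in> carrier_mat m k" and u: "u \<in> carrier_vec k"
  shows "\<exists>v \<in> carrier_vec m. (C * C\<^sup>T) *\<^sub>v v = C *\<^sub>v u"
proof -
  have CT: "C\<^sup>T \<in> carrier_mat k m" using C by simp
  obtain H where H: "H \<in> carrier_mat m m" and "C\<^sup>T * (H * C) * C\<^sup>T = C\<^sup>T" "(C\<^sup>T * (H * C))\<^sup>T = C\<^sup>T * (H * C)"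
    using exists_least_squares_inverse[OF CT] by auto
  then have inner: "(C\<^sup>T * (H * C))\<^sup>T * C\<^sup>T = C\<^sup>T" by simp
  have HC: "H * C \<in> carrier_mat m k" using H C by (rule mult_carrier_mat)
  have P: "C\<^sup>T * (H * C) \<in> carrier_mat k k" using CT HC by (rule mult_carrier_mat)
  define v where "v = (H * C) *\<^sub>v u"
  have v: "v \<in> carrier_vec m" unfolding v_def using HC u by (rule mult_mat_vec_carrier)
  have "C * (C\<^sup>T * (H * C)) = C"
    using arg_cong[OF inner, of transpose_mat] transpose_mult[of "(C\<^sup>T * (H * C))\<^sup>T" k k "C\<^sup>T" m] C P
    by simp
  then have "C *\<^sub>v u = C *\<^sub>v ((C\<^sup>T * (H * C)) *\<^sub>v u)"
    using assoc_mult_mat_vec[OF C P u] by simp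
  also have "(C\<^sup>T * (H * C)) *\<^sub>v u = C\<^sup>T *\<^sub>v v"
    unfolding v_def using CT HC u by (rule assoc_mult_mat_vec)
  also have "C *\<^sub>v (C\<^sup>T *\<^sub>v v) = (C * C\<^sup>T) *\<^sub>v v"
    using C CT v by (rule assoc_mult_mat_vec[symmetric])
  finally show ?thesis using v by metis
qed

section \<open>Column submatrices, subvectors and extension by zero\<close>

lemma col_submatrix_carrier:
  assumes "A \<in> carrier_mat m n" and "T \<subseteq> {..<n}"
  shows "col_submatrix A T \<in> carrier_mat m (card T)"
proof -
  have "{j. j < dim_col A \<and> j \<in> T} = T" using assms by auto
  then show ?thesis using assms by (auto simp: dim_submatrix)
qed

lemma col_submatrix_index:
  assumes "A \<in> carrier_mat m n" and "T \<subseteq> {..<n}" and "i < m" and "j < card T"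
  shows "col_submatrix A T $$ (i, j) = A $$ (i, pick T j)"
proof -
  have "{j. j < dim_col A \<and> j \<in> T} = T" using assms by auto
  then show ?thesis using assms by (subst submatrix_index) (auto simp: pick_UNIV)
qed

lemma subvec_carrier:
  assumes "v \<in> carrier_vec n" and "T \<subseteq> {..<n}"
  shows "subvec v T \<in> carrier_vec (card T)"
proof -
  have "{j. j < dim_vec v \<and> j \<in> T} = T" using assms by auto
  then show ?thesis by (auto simp: subvec_def)
qed

lemma subvec_index:
  assumes "v \<in> carrier_vec n" and "T \<subseteq> {..<n}" and "j < card T"
  shows "subvec v T $ j = v $ pick T j"
proof -
  have "{j. j < dim_vec v \<and> j \<in> T} = T" using assms by auto
  then show ?thesis using assms by (auto simp: subvec_def)
qed

lemma card_below_less: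
  fixes T :: "nat set"
  assumes "finite T" and "i \<in> T"
  shows "card {j \<in> T. j < i} < card T"
  using assms by (intro psubset_card_mono) auto

text \<open>This brings \<open>delta_w\<close> and \<open>delta_z\<close> into a form indexed by the
  original indices, so that positions inside subvectors disappear from the argument.\<close>

lemma extend_zero_smult_subvec:
  assumes "v \<in> carrier_vec n" and "T \<subseteq> {..<n}"
  shows "extend_zero n T (k \<cdot>\<^sub>v subvec v T) = Matrix.vec n (\<lambda>i. if i \<in> T then k * v $ i else 0)"
proof (rule eq_vecI)
  fix i assume "i < dim_vec (Matrix.vec n (\<lambda>i. if i \<in> T then k * v $ i else 0))"
  then have i: "i < n" by simp
  have fin: "finite T" using assms(2) finite_subset by blast
  show "extend_zero n T (k \<cdot>\<^sub>v subvec v T) $ i = Matrix.vec n (\<lambda>i. if i \<in> T then k * v $ i else 0) $ i"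
    using i card_below_less[OF fin, of i] subvec_carrier[OF assms] subvec_index[OF assms]
    by (auto simp: extend_zero_def pick_card_in_set)
qed (simp add: extend_zero_def)

lemma col_submatrix_mult_vec:
  assumes A: "A \<in> carrier_mat m n" and T: "T \<subseteq> {..<n}" and u: "u \<in> carrier_vec (card T)"
  shows "col_submatrix A T *\<^sub>v u = A *\<^sub>v extend_zero n T u"
proof (rule eq_vecI)
  note AT = col_submatrix_carrier[OF A T]
  have fin: "finite T" using T finite_subset by blast
  fix i assume "i < dim_vec (A *\<^sub>v extend_zero n T u)"
  then have i: "i < m" using A by simp
  have "(col_submatrix A T *\<^sub>v u) $ i = (\<Sum>j<card T. A $$ (i, pick T j) * u $ j)"
    using AT i u by (auto simp: scalar_prod_def lessThan_atLeast0 col_submatrix_index[OF A T] intro!: sum.cong)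
  also have "\<dots> = (\<Sum>k\<in>T. A $$ (i, k) * u $ card {j \<in> T. j < k})"
    \<comment> \<open>\<open>pick T\<close> and the count of smaller elements of \<open>T\<close>
      are mutually inverse bijections between positions and elements.\<close>
    by (rule sum.reindex_bij_witness[where i = "\<lambda>k. card {j \<in> T. j < k}" and j = "pick T"])
       (auto simp: card_pick_le pick_in_set_le pick_card_in_set card_below_less[OF fin])
  also have "\<dots> = (\<Sum>k\<in>T. A $$ (i, k) * extend_zero n T u $ k)"
    using T by (intro sum.cong) (auto simp: extend_zero_def)
  also have "\<dots> = (\<Sum>k<n. A $$ (i, k) * extend_zero n T u $ k)"
    using T by (intro sum.mono_neutral_left) (auto simp: extend_zero_def)
  also have "\<dots> = (A *\<^sub>v extend_zero n T u) $ i"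
    using A i by (auto simp: scalar_prod_def lessThan_atLeast0 extend_zero_def intro!: sum.cong)
  finally show "(col_submatrix A T *\<^sub>v u) $ i = (A *\<^sub>v extend_zero n T u) $ i" .
qed (use A col_submatrix_carrier[OF A T] in auto)

lemma col_submatrix_transpose_mult_vec:
  assumes A: "A \<in> carrier_mat m n" and T: "T \<subseteq> {..<n}" and p: "p \<in> carrier_vec m"
  shows "(col_submatrix A T)\<^sup>T *\<^sub>v p = subvec (A\<^sup>T *\<^sub>v p) T"
proof (rule eq_vecI)
  note AT = col_submatrix_carrier[OF A T]
  have q: "A\<^sup>T *\<^sub>v p \<in> carrier_vec n" using A p by (intro mult_mat_vec_carrier) auto
  fix j assume "j < dim_vec (subvec (A\<^sup>T *\<^sub>v p) T)"
  then have j: "j < card T" using subvec_carrier[OF q T] by simp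
  have "pick T j < n" using pick_in_set_le[OF j] T by auto
  then show "((col_submatrix A T)\<^sup>T *\<^sub>v p) $ j = subvec (A\<^sup>T *\<^sub>v p) T $ j"
    using AT A p j by (auto simp: subvec_index[OF q T j] scalar_prod_def col_submatrix_index[OF A T] intro!: sum.cong)
qed (use A p col_submatrix_carrier[OF A T] subvec_carrier[of "A\<^sup>T *\<^sub>v p" n T] T in auto)

lemma all_pick_iff:
  assumes "finite T"
  shows "(\<forall>j<card T. P (pick T j)) \<longleftrightarrow> (\<forall>i\<in>T. P i)"
  using card_below_less[OF assms] pick_card_in_set pick_in_set_le by metis

lemma all_less_add_iff:
  fixes a b :: nat
  shows "(\<forall>i<a + b. Q i) \<longleftrightarrow> (\<forall>i<a. Q i) \<and> (\<forall>j<b. Q (a + j))" (is "?l \<longleftrightarrow> ?r")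
proof
  assume r: ?r
  show ?l
  proof (intro allI impI)
    fix i assume "i < a + b"
    then show "Q i" using r[THEN conjunct1, rule_format, of i] r[THEN conjunct2, rule_format, of "i - a"]
      by (cases "i < a") auto
  qed
qed auto

section \<open>Entrywise optimality conditions and the path of triplets\<close>

lemma optimal_triplet_iff:
  assumes A: "A \<in> carrier_mat m n" and c: "c \<in> carrier_vec n"
    and w: "w \<in> carrier_vec n" and y: "y \<in> carrier_vec m" and z: "z \<in> carrier_vec n"
  shows "optimal_triplet A d c w y z \<longleftrightarrow>
    (\<forall>i<n. w $ i = c $ i + (A\<^sup>T *\<^sub>v y) $ i + z $ i) \<and> A *\<^sub>v w = d \<and>
    (\<forall>i<n. z $ i * w $ i = 0 \<and> 0 \<le> w $ i \<and> 0 \<le> z $ i)"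
proof -
  have "w - c - A\<^sup>T *\<^sub>v y - z = 0\<^sub>v n \<longleftrightarrow> (\<forall>i<n. w $ i = c $ i + (A\<^sup>T *\<^sub>v y) $ i + z $ i)"
    (is "?l = ?r")
  proof
    assume l: ?l
    show ?r
    proof (intro allI impI)
      fix i assume "i < n"
      then show "w $ i = c $ i + (A\<^sup>T *\<^sub>v y) $ i + z $ i"
        using arg_cong[OF l, of "\<lambda>v. v $ i"] A c w z by simp
    qed
  next
    assume ?r
    then show ?l using A c w z by (intro eq_vecI) auto
  qed
  \<comment> \<open>For nonnegative entries the scalar product is a sum of nonnegative terms, so it
    vanishes only if every term does.\<close>
  moreover have "z \<bullet> w = 0 \<longleftrightarrow> (\<forall>i<n. z $ i * w $ i = 0)"
    if "\<forall>i<n. 0 \<le> w $ i \<and> 0 \<le> z $ i"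
  proof -
    have "z \<bullet> w = 0 \<longleftrightarrow> (\<forall>i\<in>{0..<n}. z $ i * w $ i = 0)"
      unfolding scalar_prod_def using that w by (subst sum_nonneg_eq_0_iff) auto
    then show ?thesis by (simp add: Ball_def)
  qed
  ultimately show ?thesis
    using A w y z by (auto simp: optimal_triplet_def less_eq_vec_def)
qed

lemma optimal_triplet_carrier:
  assumes "A \<in> carrier_mat m n" and "optimal_triplet A d c w y z"
  shows "w \<in> carrier_vec n" "y \<in> carrier_vec m" "z \<in> carrier_vec n"
  using assms by (auto simp: optimal_triplet_def)

lemma optimal_tripletD:
  assumes "A \<in> carrier_mat m n" and "c \<in> carrier_vec n" and "optimal_triplet A d c w y z"
  shows "\<forall>i<n. w $ i = c $ i + (A\<^sup>T *\<^sub>v y) $ i + z $ i" and "A *\<^sub>v w = d"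
    and "\<forall>i<n. z $ i * w $ i = 0 \<and> 0 \<le> w $ i \<and> 0 \<le> z $ i"
proof -
  note D = iffD1[OF optimal_triplet_iff[OF assms(1,2) optimal_triplet_carrier[OF assms(1,3)]] assms(3)]
  show "\<forall>i<n. w $ i = c $ i + (A\<^sup>T *\<^sub>v y) $ i + z $ i" by (rule D[THEN conjunct1])
  show "A *\<^sub>v w = d" by (rule D[THEN conjunct2, THEN conjunct1])
  show "\<forall>i<n. z $ i * w $ i = 0 \<and> 0 \<le> w $ i \<and> 0 \<le> z $ i" by (rule D[THEN conjunct2, THEN conjunct2])
qed

text \<open>The step \<open>t\<close> is an arbitrary real: the finite parameters \<open>R'\<close>
  use \<open>t = 1 / R - 1 / R'\<close>, and the limit case uses \<open>t = 1 / R\<close>, which no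
  finite \<open>R'\<close> attains.\<close>

lemma optimal_triplet_path:
  assumes A: "A \<in> carrier_mat m n" and c: "c \<in> carrier_vec n" and d: "d \<in> carrier_vec m"
    and p: "p \<in> carrier_vec m" and opt: "optimal_triplet A d c w y z"
    and N: "N = {i. i < n \<and> z $ i > 0}" and B: "B = {i. i < n \<and> w $ i > 0}"
    and q: "q = A\<^sup>T *\<^sub>v p"
    and degenerate: "\<forall>i<n. w $ i = 0 \<longrightarrow> z $ i = 0 \<longrightarrow> q $ i = 0"
    and solves: "A *\<^sub>v Matrix.vec n (\<lambda>i. if i \<in> B then q $ i else 0) = b"
  shows "optimal_triplet A (d - t \<cdot>\<^sub>v b) c
      (w + Matrix.vec n (\<lambda>i. if i \<in> B then - t * q $ i else 0)) (y + (- t) \<cdot>\<^sub>v p)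
      (z + Matrix.vec n (\<lambda>i. if i \<in> N then t * q $ i else 0)) \<longleftrightarrow>
    (\<forall>i\<in>B. t * q $ i \<le> w $ i) \<and> (\<forall>i\<in>N. - (t * q $ i) \<le> z $ i)"
    (is "optimal_triplet A _ c ?w ?y ?z \<longleftrightarrow> _")
proof -
  note [simp] = optimal_triplet_carrier[OF A opt]
  have AT: "A\<^sup>T \<in> carrier_mat n m" using A by simp
  have opt': "\<forall>i<n. w $ i = c $ i + (A\<^sup>T *\<^sub>v y) $ i + z $ i" "A *\<^sub>v w = d"
    and sign: "\<forall>i<n. z $ i * w $ i = 0 \<and> 0 \<le> w $ i \<and> 0 \<le> z $ i"
    by (rule optimal_tripletD[OF A c opt])+
  have w': "?w \<in> carrier_vec n" and y': "?y \<in> carrier_vec m" and z': "?z \<in> carrier_vec n"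
    using p by auto
  have wi: "?w $ i = (if i \<in> B then w $ i - t * q $ i else 0)"
    and zi: "?z $ i = (if i \<in> N then z $ i + t * q $ i else 0)"
    and disjoint: "i \<notin> B \<or> i \<notin> N" if "i < n" for i
    using that sign by (force simp: N B)+
  have "A\<^sup>T *\<^sub>v ?y = A\<^sup>T *\<^sub>v y + (- t) \<cdot>\<^sub>v q"
    using AT p by (simp add: q mult_add_distrib_mat_vec[OF AT] mult_mat_vec[OF AT])
  moreover have "q \<in> carrier_vec n" unfolding q using AT p by (rule mult_mat_vec_carrier)
  ultimately have ATy: "(A\<^sup>T *\<^sub>v ?y) $ i = (A\<^sup>T *\<^sub>v y) $ i - t * q $ i" if "i < n" for i
    using that A by simp
  \<comment> \<open>Under the step, \<open>A\<^sup>T y\<close> changes by \<open>- t q\<close>. On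
    \<open>B\<close> the change of \<open>w\<close> matches this, on \<open>N\<close> the change of
    \<open>z\<close> cancels it, and at all other indices \<open>q\<close> vanishes by
    \<open>degenerate\<close>.\<close>
  have dual: "\<forall>i<n. ?w $ i = c $ i + (A\<^sup>T *\<^sub>v ?y) $ i + ?z $ i"
  proof (intro allI impI)
    fix i assume i: "i < n"
    have "w $ i = c $ i + (A\<^sup>T *\<^sub>v y) $ i + z $ i" using opt' i by blast
    moreover have "i \<notin> B \<Longrightarrow> w $ i = 0" "i \<notin> N \<Longrightarrow> z $ i = 0" using i sign by (force simp: B N)+
    ultimately show "?w $ i = c $ i + (A\<^sup>T *\<^sub>v ?y) $ i + ?z $ i"
      unfolding wi[OF i] zi[OF i] ATy[OF i] using degenerate i disjoint[OF i] by auto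
  qed
  let ?qB = "Matrix.vec n (\<lambda>i. if i \<in> B then q $ i else 0)"
  have "Matrix.vec n (\<lambda>i. if i \<in> B then - t * q $ i else 0) = (- t) \<cdot>\<^sub>v ?qB"
    by (intro eq_vecI) auto
  then have "A *\<^sub>v ?w = d + (- t) \<cdot>\<^sub>v b"
    using A opt'(2) by (simp add: mult_add_distrib_mat_vec[OF A] mult_mat_vec[OF A] solves)
  moreover have "b \<in> carrier_vec m" using solves A by auto
  ultimately have primal: "A *\<^sub>v ?w = d - t \<cdot>\<^sub>v b" using d by auto
  have "(\<forall>i<n. ?z $ i * ?w $ i = 0 \<and> 0 \<le> ?w $ i \<and> 0 \<le> ?z $ i) \<longleftrightarrow>
    (\<forall>i\<in>B. t * q $ i \<le> w $ i) \<and> (\<forall>i\<in>N. - (t * q $ i) \<le> z $ i)" (is "?l \<longleftrightarrow> ?r")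
  proof
    assume l: ?l
    show ?r
    proof (intro conjI ballI)
      fix i assume i: "i \<in> B"
      then have "i < n" by (simp add: B)
      then show "t * q $ i \<le> w $ i" using l wi[of i] i by force
    next
      fix i assume i: "i \<in> N"
      then have "i < n" by (simp add: N)
      then show "- (t * q $ i) \<le> z $ i" using l zi[of i] i by force
    qed
  next
    assume r: ?r
    show ?l
    proof (intro allI impI)
      fix i assume i: "i < n"
      show "?z $ i * ?w $ i = 0 \<and> 0 \<le> ?w $ i \<and> 0 \<le> ?z $ i"
        unfolding wi[OF i] zi[OF i] using r disjoint[OF i] by force
    qed
  qed
  note nonneg = this
  have "(P \<and> Q \<and> S) \<longleftrightarrow> T" if P Q "S \<longleftrightarrow> T" for P Q S T using that by blast
  from this[OF dual primal nonneg] show ?thesis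
    by (simp only: optimal_triplet_iff[OF A c w' y' z'])
qed

section \<open>Optimality for the linear program, and the ratio test\<close>

lemma lp_feasible_iff:
  assumes "A \<in> carrier_mat m n"
  shows "v \<in> lp_feasible A b \<longleftrightarrow> v \<in> carrier_vec n \<and> A *\<^sub>v v = b \<and> (\<forall>i<n. 0 \<le> v $ i)"
proof -
  have "0\<^sub>v n \<le> v \<longleftrightarrow> (\<forall>i<n. 0 \<le> v $ i)" if "v \<in> carrier_vec n"
    using carrier_vecD[OF that] by (simp add: less_eq_vec_def)
  then show ?thesis
    unfolding lp_feasible_def carrier_matD(2)[OF assms] by blast
qed

text \<open>
  The point \<open>w\<close> of a triplet for \<open>d = 0\<close> is a recession direction of the feasible set with
  \<open>c \<bullet> w = w \<bullet> w\<close>, so it vanishes when the value of the linear program is finite; then \<open>- y\<close>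
  is dual feasible with slack \<open>z\<close>.
\<close>

lemma lp_optimal_of_homogeneous_triplet:
  assumes A: "A \<in> carrier_mat m n" and c: "c \<in> carrier_vec n"
    and finite_value: "\<bar>lp_value A b c\<bar> \<noteq> \<infinity>"
    and opt: "optimal_triplet A (0\<^sub>v m) c w y z"
    and x: "x \<in> lp_feasible A b" and zx: "z \<bullet> x = 0"
  shows "lp_optimal A b c x"
proof -
  note carr [simp] = optimal_triplet_carrier[OF A opt]
  have AT: "A\<^sup>T \<in> carrier_mat n m" using A by simp
  have dual: "\<forall>i<n. w $ i = c $ i + (A\<^sup>T *\<^sub>v y) $ i + z $ i" and Aw: "A *\<^sub>v w = 0\<^sub>v m"
    and sign: "\<forall>i<n. z $ i * w $ i = 0 \<and> 0 \<le> w $ i \<and> 0 \<le> z $ i"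
    by (rule optimal_tripletD[OF A c opt])+
  have feas: "v \<in> carrier_vec n" "A *\<^sub>v v = b" "\<forall>i<n. 0 \<le> v $ i" if "v \<in> lp_feasible A b" for v
    using that[unfolded lp_feasible_iff[OF A]] by simp_all
  \<comment> \<open>The dual equation paired with \<open>v\<close>. For feasible \<open>v\<close>
    the middle term is the constant \<open>y \<bullet> b\<close>, so objective values differ only
    through the products with \<open>w\<close> and \<open>z\<close>.\<close>
  have cv: "c \<bullet> v = w \<bullet> v - y \<bullet> (A *\<^sub>v v) - z \<bullet> v" if v: "v \<in> carrier_vec n" for v
  proof -
    have "y \<bullet> (A *\<^sub>v v) = (A\<^sup>T *\<^sub>v y) \<bullet> v"
      using transpose_vec_mult_scalar[OF A v, of y] by simp
    moreover have "c \<bullet> v = (\<Sum>i<n. (w $ i - (A\<^sup>T *\<^sub>v y) $ i - z $ i) * v $ i)"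
    proof -
      have c_eq: "c $ i = w $ i - (A\<^sup>T *\<^sub>v y) $ i - z $ i" if "i < n" for i
        using dual[rule_format, OF that] by linarith
      show ?thesis
        unfolding scalar_prod_def lessThan_atLeast0 using v
        by (intro sum.cong) (auto simp: c_eq simp del: index_mult_mat_vec)
    qed
    moreover have "\<dots> = w \<bullet> v - (A\<^sup>T *\<^sub>v y) \<bullet> v - z \<bullet> v"
      using v by (simp add: scalar_prod_def lessThan_atLeast0 left_diff_distrib sum_subtractf
          del: index_mult_mat_vec)
    ultimately show ?thesis by simp
  qed
  have zw: "z \<bullet> w = 0"
    unfolding scalar_prod_def carrier_vecD[OF carr(1)] using sign by (intro sum.neutral) auto
  have cw: "c \<bullet> w = w \<bullet> w" using cv[of w] Aw zw by simp
  obtain r where r: "lp_value A b c = ereal r" using finite_value by (cases "lp_value A b c") auto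
  have bound: "c \<bullet> v \<le> r" if "v \<in> lp_feasible A b" for v
  proof -
    have "ereal (c \<bullet> v) \<le> lp_value A b c" unfolding lp_value_def using that by (rule SUP_upper)
    then show ?thesis by (simp add: r)
  qed
  note xf = feas[OF x]
  have line: "c \<bullet> x + s * (w \<bullet> w) \<le> r" if s: "s \<ge> 0" for s
  proof -
    have "A *\<^sub>v (x + s \<cdot>\<^sub>v w) = b"
    proof -
      have "A *\<^sub>v (x + s \<cdot>\<^sub>v w) = b + s \<cdot>\<^sub>v 0\<^sub>v m"
        using xf by (simp add: mult_add_distrib_mat_vec[OF A] mult_mat_vec[OF A] Aw)
      moreover have "b \<in> carrier_vec m" using xf A by auto
      then have "b + s \<cdot>\<^sub>v 0\<^sub>v m = b" by (intro eq_vecI) auto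
      ultimately show ?thesis by simp
    qed
    moreover have "\<forall>i<n. 0 \<le> (x + s \<cdot>\<^sub>v w) $ i"
      using xf(3) s sign by (simp add: carrier_vecD[OF carr(1)] add_nonneg_nonneg)
    ultimately have "x + s \<cdot>\<^sub>v w \<in> lp_feasible A b"
      unfolding lp_feasible_iff[OF A] using xf(1) by simp
    then have "c \<bullet> (x + s \<cdot>\<^sub>v w) \<le> r" by (rule bound)
    then show ?thesis using c xf cw by (simp add: scalar_prod_add_distrib[of _ n])
  qed
  have "w \<bullet> w \<ge> 0" by (simp add: scalar_prod_def sum_nonneg)
  have "w \<bullet> w = 0"
  proof (rule ccontr)
    assume "w \<bullet> w \<noteq> 0"
    then have pos: "w \<bullet> w > 0" using \<open>w \<bullet> w \<ge> 0\<close> by simp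
    \<comment> \<open>This step length raises the objective along the ray to \<open>r + 1\<close>,
      beyond the optimal value \<open>r\<close>.\<close>
    let ?s = "(r - c \<bullet> x + 1) / (w \<bullet> w)"
    have "?s \<ge> 0" using pos bound[OF x] by simp
    from line[OF this] show False using pos by simp
  qed
  then have w0: "w = 0\<^sub>v n" using scalar_prod_self_eq_0[of w n] by simp
  have "c \<bullet> v \<le> c \<bullet> x" if v: "v \<in> lp_feasible A b" for v
  proof -
    note vf = feas[OF v]
    have "z \<bullet> v \<ge> 0" using vf sign by (auto simp: scalar_prod_def intro!: sum_nonneg)
    moreover have "w \<bullet> v = 0" "w \<bullet> x = 0" unfolding w0 using vf(1) xf(1) by simp_all
    ultimately show ?thesis unfolding cv[OF vf(1)] cv[OF xf(1)] vf(2) xf(2) zx by simp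
  qed
  then show ?thesis using x by (simp add: lp_optimal_def)
qed

text \<open>If \<open>e $ i > 0\<close>, then \<open>f $ i > R * e $ i > 0\<close>, so the entry
  takes part in the minimum and bounds \<open>R'\<close> by its ratio. If
  \<open>e $ i \<le> 0\<close>, raising \<open>R\<close> to \<open>R'\<close> cannot increase
  \<open>R * e $ i\<close>, so the inequality persists.\<close>

lemma ratio_min_ge_iff:
  assumes below: "\<forall>i<dim_vec e. R * e $ i < f $ i" and R: "0 < R" "R \<le> R'"
  shows "ereal R' \<le> ratio_min e f \<longleftrightarrow> (\<forall>i<dim_vec e. R' * e $ i \<le> f $ i)"
proof -
  have "R' * e $ i \<le> f $ i \<longleftrightarrow> (e $ i > 0 \<and> f $ i > 0 \<longrightarrow> R' \<le> f $ i / e $ i)" if i: "i < dim_vec e" for i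
  proof (cases "e $ i > 0")
    case True
    then have "0 < R * e $ i" using R by simp
    then have "f $ i > 0" using below[rule_format, OF i] by simp
    then show ?thesis using True by (simp add: pos_le_divide_eq)
  next
    case False
    then have "R' * e $ i \<le> R * e $ i" using R by (intro mult_right_mono_neg) auto
    then show ?thesis using below[rule_format, OF i] False by simp
  qed
  then show ?thesis by (auto simp: ratio_min_def le_INF_iff)
qed

text \<open>An entry with \<open>e $ i > 0\<close> also has \<open>f $ i > 0\<close> and would
  contribute a finite ratio.\<close>

lemma ratio_min_eq_infinity:
  assumes below: "\<forall>i<dim_vec e. R * e $ i < f $ i" and R: "0 < R"
    and infinite: "ratio_min e f = \<infinity>" and i: "i < dim_vec e"
  shows "e $ i \<le> 0"
proof (rule ccontr)
  assume "\<not> e $ i \<le> 0"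
  then have e: "e $ i > 0" by simp
  then have "0 < R * e $ i" using R by simp
  then have "f $ i > 0" using below[rule_format, OF i] by simp
  then have "ratio_min e f \<le> ereal (f $ i / e $ i)"
    unfolding ratio_min_def using e i by (intro INF_lower) auto
  then show False using infinite by simp
qed

section \<open>From the pseudoinverse direction to the largest parameter\<close>

theorem theorem4p4:
  fixes A V :: "real mat" and b c w y z p b\<^sub>B b\<^sub>N e f :: "real vec"
    and m n :: nat and B N Z :: "nat set" and R :: real and R\<^sub>n :: ereal
  assumes A: "A \<in> carrier_mat m n" and full_row_rank: "vec_space.rank m A = m"
    and b: "b \<in> carrier_vec m" and c: "c \<in> carrier_vec n"
    and finite_value: "\<bar>lp_value A b c\<bar> \<noteq> \<infinity>"
    and R: "R > 0"
    and opt: "optimal_triplet A ((1 / R) \<cdot>\<^sub>v b) c w y z"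
    and N: "N = {i. i < n \<and> z $ i > 0}"
    and B: "B = {i. i < n \<and> w $ i > 0}"
    and Z: "Z = {i. i < n \<and> w $ i = 0 \<and> z $ i = 0}"
    and V: "admissible_V A Z V"
    and solvable: "Z \<noteq> {} \<Longrightarrow> \<exists>u \<in> carrier_vec (dim_col V). step_matrix A B V *\<^sub>v u = b"
    and p: "p = dy_p A B V b"
    and bB: "b\<^sub>B = transpose_mat (col_submatrix A B) *\<^sub>v p"
    and bN: "b\<^sub>N = transpose_mat (col_submatrix A N) *\<^sub>v p"
    and e: "e = (b\<^sub>B - R \<cdot>\<^sub>v subvec w B) @\<^sub>v (- (b\<^sub>N + R \<cdot>\<^sub>v subvec z N))"
    and f: "f = (R \<cdot>\<^sub>v b\<^sub>B) @\<^sub>v (- (R \<cdot>\<^sub>v b\<^sub>N))"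
    and Rn: "R\<^sub>n = ratio_min e f"
  shows "ereal R \<le> R\<^sub>n \<and>
     (\<forall>R' \<ge> R. maintained A b c B N p R w y z R' \<longleftrightarrow> ereal R' \<le> R\<^sub>n) \<and>
     (R\<^sub>n < \<infinity> \<longrightarrow>
        optimal_triplet A ((1 / real_of_ereal R\<^sub>n) \<cdot>\<^sub>v b) c
          (w + delta_w n B R (real_of_ereal R\<^sub>n) b\<^sub>B)
          (y + delta_y R (real_of_ereal R\<^sub>n) p)
          (z + delta_z n N R (real_of_ereal R\<^sub>n) b\<^sub>N)) \<and>
     (R\<^sub>n = \<infinity> \<longrightarrow> lp_optimal A b c (R \<cdot>\<^sub>v w))"
proof -
  note w = optimal_triplet_carrier(1)[OF A opt] and y = optimal_triplet_carrier(2)[OF A opt]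
    and z = optimal_triplet_carrier(3)[OF A opt]
  have opt': "\<forall>i<n. w $ i = c $ i + (A\<^sup>T *\<^sub>v y) $ i + z $ i" and Aw: "A *\<^sub>v w = (1 / R) \<cdot>\<^sub>v b"
    and sign: "\<forall>i<n. z $ i * w $ i = 0 \<and> 0 \<le> w $ i \<and> 0 \<le> z $ i"
    by (rule optimal_tripletD[OF A c opt])+
  have subs: "B \<subseteq> {..<n}" "N \<subseteq> {..<n}" "Z \<subseteq> {..<n}" by (auto simp: B N Z)
  then have fin: "finite B" "finite N" by (auto intro: finite_subset)
  define C where "C = col_submatrix A B"
  have C: "C \<in> carrier_mat m (card B)" unfolding C_def by (rule col_submatrix_carrier[OF A subs(1)])
  have CT: "C\<^sup>T \<in> carrier_mat (card B) m" using C by simp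
  have CCT: "C * C\<^sup>T \<in> carrier_mat m m" using C CT by (rule mult_carrier_mat)
  have Vc: "V \<in> carrier_mat m (dim_col V)"
    using V A by (cases "Z = {}") (auto simp: admissible_V_def)
  define M where "M = step_matrix A B V"
  have M_eq: "M = C * C\<^sup>T * V" by (simp add: M_def step_matrix_def C_def)
  have M: "M \<in> carrier_mat m (dim_col V)" unfolding M_eq using CCT Vc by (rule mult_carrier_mat)
  have "\<exists>u \<in> carrier_vec (dim_col V). M *\<^sub>v u = b"
  proof (cases "Z = {}")
    \<comment> \<open>Here \<open>V\<close> is the identity and \<open>b = A (R w)\<close>. As
      \<open>w\<close> is supported on \<open>B\<close>, \<open>b\<close> lies in the range of
      \<open>C\<close>, which is contained in that of \<open>C C\<^sup>T\<close>.\<close>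
    case True
    then have V1: "V = 1\<^sub>m m" using V A by (simp add: admissible_V_def)
    have wB: "R \<cdot>\<^sub>v subvec w B \<in> carrier_vec (card B)" using subvec_carrier[OF w subs(1)] by simp
    have "extend_zero n B (R \<cdot>\<^sub>v subvec w B) = R \<cdot>\<^sub>v w"
      unfolding extend_zero_smult_subvec[OF w subs(1)] using w sign
      by (intro eq_vecI) (force simp: B)+
    then have "C *\<^sub>v (R \<cdot>\<^sub>v subvec w B) = A *\<^sub>v (R \<cdot>\<^sub>v w)"
      unfolding C_def col_submatrix_mult_vec[OF A subs(1) wB] by simp
    also have "\<dots> = b" using R b by (simp add: mult_mat_vec[OF A w] Aw smult_smult_assoc)
    finally have "C *\<^sub>v (R \<cdot>\<^sub>v subvec w B) = b" .
    then obtain v where "v \<in> carrier_vec m" "(C * C\<^sup>T) *\<^sub>v v = b"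
      using range_subset_range_gram[OF C wB] by auto
    then show ?thesis using CCT by (auto simp: M_eq V1 right_mult_one_mat[OF CCT])
  next
    case False
    then show ?thesis using solvable by (simp add: M_def)
  qed
  then have Mb: "M *\<^sub>v (moore_penrose M *\<^sub>v b) = b" using moore_penrose_solves[OF M] by auto
  have mp_b: "moore_penrose M *\<^sub>v b \<in> carrier_vec (dim_col V)"
    using is_moore_penrose_moore_penrose[of M] M b
    by (intro mult_mat_vec_carrier[of _ _ m]) (auto simp: is_moore_penrose_def)
  have p_eq: "p = V *\<^sub>v (moore_penrose M *\<^sub>v b)" by (simp add: p dy_p_def M_def)
  have pc: "p \<in> carrier_vec m" unfolding p_eq using Vc mp_b by (rule mult_mat_vec_carrier)
  define q where "q = A\<^sup>T *\<^sub>v p"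
  have q: "q \<in> carrier_vec n" unfolding q_def using A pc by (intro mult_mat_vec_carrier) auto
  have bB': "b\<^sub>B = subvec q B" and bN': "b\<^sub>N = subvec q N"
    unfolding bB bN q_def using col_submatrix_transpose_mult_vec[OF A _ pc] subs by auto
  \<comment> \<open>\<open>p\<close> lies in the range of \<open>V\<close>, which is the null space
    of \<open>A\<^sub>Z\<^sup>T\<close>, so \<open>q\<close> vanishes on \<open>Z\<close>.\<close>
  have degenerate: "q $ i = 0" if i: "i < n" "w $ i = 0" "z $ i = 0" for i
  proof -
    have iZ: "i \<in> Z" using i by (simp add: Z)
    then have "Z \<noteq> {}" by blast
    then have col: "vec_space.col_space m V = mat_kernel (col_submatrix A Z)\<^sup>T"
      using V unfolding admissible_V_def carrier_matD(1)[OF Vc] carrier_matD(1)[OF A] by simp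
    have "p \<in> vec_space.col_space m V"
      unfolding vec_space.col_space_eq[OF Vc] carrier_matD(1)[OF Vc] using pc mp_b p_eq by blast
    then have "(col_submatrix A Z)\<^sup>T *\<^sub>v p = 0\<^sub>v (card Z)"
      unfolding col using mat_kernelD(2)[of "(col_submatrix A Z)\<^sup>T" "card Z" m p]
        col_submatrix_carrier[OF A subs(3)] by simp
    then have "subvec q Z = 0\<^sub>v (card Z)"
      using col_submatrix_transpose_mult_vec[OF A subs(3) pc] by (simp add: q_def)
    then have "\<forall>j<card Z. q $ pick Z j = 0"
      using subvec_index[OF q subs(3)] by (metis index_zero_vec(1))
    moreover have "finite Z" using subs(3) by (rule finite_subset) simp
    ultimately show ?thesis using iZ by (simp add: all_pick_iff[where P = "\<lambda>i. q $ i = 0"])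
  qed
  have "C *\<^sub>v (C\<^sup>T *\<^sub>v p) = b"
    using assoc_mult_mat_vec[OF CCT Vc mp_b] assoc_mult_mat_vec[OF C CT pc] Mb
    by (simp add: p_eq M_eq)
  \<comment> \<open>The factor 1 gives the zero extension the shape that
    \<open>extend_zero_smult_subvec\<close> rewrites.\<close>
  moreover have "C *\<^sub>v subvec q B = A *\<^sub>v extend_zero n B (1 \<cdot>\<^sub>v subvec q B)"
    using col_submatrix_mult_vec[OF A subs(1) subvec_carrier[OF q subs(1)]] by (simp add: C_def)
  ultimately have solves: "A *\<^sub>v Matrix.vec n (\<lambda>i. if i \<in> B then q $ i else 0) = b"
    using bB bB' unfolding extend_zero_smult_subvec[OF q subs(1)] by (simp add: C_def cong: if_cong)
  have d: "(1 / R) \<cdot>\<^sub>v b \<in> carrier_vec m" using b by simp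
  have "\<forall>i<n. w $ i = 0 \<longrightarrow> z $ i = 0 \<longrightarrow> q $ i = 0" using degenerate by blast
  note path = optimal_triplet_path[OF A c d pc opt N B q_def this solves]

  let ?w = "\<lambda>R'. w + delta_w n B R R' b\<^sub>B" and ?y = "\<lambda>R'. y + delta_y R R' p"
    and ?z = "\<lambda>R'. z + delta_z n N R R' b\<^sub>N"
  have optimal_iff: "optimal_triplet A ((1 / R') \<cdot>\<^sub>v b) c (?w R') (?y R') (?z R') \<longleftrightarrow>
      (\<forall>i\<in>B. R' * (q $ i - R * w $ i) \<le> R * q $ i) \<and>
      (\<forall>i\<in>N. R' * - (q $ i + R * z $ i) \<le> - (R * q $ i))" if R': "R' \<ge> R" for R'
  proof -
    define t where "t = (R' - R) / (R * R')"
    have "R' > 0" using R R' by simp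
    then have pos: "R * R' > 0" using R by simp
    have t: "t * (R * R') = R' - R" using R \<open>R' > 0\<close> by (simp add: t_def)
    have "1 / R = 1 / R' + t" using R \<open>R' > 0\<close> by (simp add: t_def field_simps)
    then have rhs: "(1 / R) \<cdot>\<^sub>v b - t \<cdot>\<^sub>v b = (1 / R') \<cdot>\<^sub>v b"
      by (simp only: add_smult_distrib_vec) (intro eq_vecI, auto)
    have dw: "delta_w n B R R' b\<^sub>B = Matrix.vec n (\<lambda>i. if i \<in> B then - t * q $ i else 0)"
      and dz: "delta_z n N R R' b\<^sub>N = Matrix.vec n (\<lambda>i. if i \<in> N then t * q $ i else 0)"
      unfolding delta_w_def delta_z_def bB' bN' t_def extend_zero_smult_subvec[OF q subs(1)]
        extend_zero_smult_subvec[OF q subs(2)] by (rule refl)+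
    have "(R - R') / (R * R') = - t" by (simp add: t_def minus_divide_left)
    then have dy: "delta_y R R' p = (- t) \<cdot>\<^sub>v p" by (simp only: delta_y_def)
    \<comment> \<open>Multiplying by \<open>R R' > 0\<close> turns the left side into
      \<open>(R' - R) x\<close>; collecting the terms with \<open>R'\<close> produces the entries of
      \<open>e\<close> and \<open>f\<close>.\<close>
    have step_le: "t * x \<le> s \<longleftrightarrow> R' * (x - R * s) \<le> R * x" for x s
    proof -
      have "t * x \<le> s \<longleftrightarrow> t * (R * R') * x \<le> s * (R * R')"
        using mult_le_cancel_right_pos[OF pos, of "t * x" s] by (simp add: mult_ac)
      then show ?thesis unfolding t by (simp add: algebra_simps)
    qed
    have step_le_neg: "- (t * x) \<le> s \<longleftrightarrow> R' * - (x + R * s) \<le> - (R * x)" for x s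
      using step_le[of "- x" s] by simp
    show ?thesis
      unfolding dw dz dy rhs[symmetric] path[of t] by (simp only: step_le step_le_neg)
  qed
  \<comment> \<open>The changes are supported on \<open>B\<close> and \<open>N\<close>, and the sign
    conditions are part of optimality, so the extra clauses of \<open>maintained\<close> follow from
    optimality.\<close>
  have maintained_iff: "maintained A b c B N p R w y z R' \<longleftrightarrow>
      optimal_triplet A ((1 / R') \<cdot>\<^sub>v b) c (?w R') (?y R') (?z R')" for R'
  proof -
    have nA: "dim_col A = n" using A by simp
    have "?w R' $ i = 0" if "i < n" "i \<notin> B" for i
      using that sign w by (force simp: delta_w_def extend_zero_def B)
    moreover have "?z R' $ i = 0" if "i < n" "i \<notin> N" for i
      using that sign z by (force simp: delta_z_def extend_zero_def N)
    moreover have "?w R' $ i \<ge> 0 \<and> ?z R' $ i \<ge> 0"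
      if "i < n" "optimal_triplet A ((1 / R') \<cdot>\<^sub>v b) c (?w R') (?y R') (?z R')" for i
      using that A by (auto simp: optimal_triplet_def less_eq_vec_def)
    ultimately show ?thesis
      unfolding maintained_def Let_def nA bB[symmetric] bN[symmetric] by blast
  qed

  \<comment> \<open>The predicate is kept general because the same splitting of \<open>e\<close> and
    \<open>f\<close> into blocks serves \<open>R e < f\<close>, \<open>R' e \<le> f\<close> and
    \<open>e \<le> 0\<close>.\<close>
  have entries: "(\<forall>i<dim_vec e. P (e $ i) (f $ i)) \<longleftrightarrow>
      (\<forall>i\<in>B. P (q $ i - R * w $ i) (R * q $ i)) \<and>
      (\<forall>i\<in>N. P (- (q $ i + R * z $ i)) (- (R * q $ i)))" for P
  proof -
    note dims = subvec_carrier[OF q subs(1)] subvec_carrier[OF w subs(1)]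
      subvec_carrier[OF q subs(2)] subvec_carrier[OF z subs(2)]
    have dim: "dim_vec e = card B + card N" using dims by (simp add: e bB' bN')
    have "e $ j = q $ pick B j - R * w $ pick B j" "f $ j = R * q $ pick B j" if "j < card B" for j
      using that dims subvec_index[OF q subs(1)] subvec_index[OF w subs(1)] by (simp_all add: e f bB' bN')
    moreover have "e $ (card B + j) = - (q $ pick N j + R * z $ pick N j)"
      "f $ (card B + j) = - (R * q $ pick N j)" if "j < card N" for j
      using that dims subvec_index[OF q subs(2)] subvec_index[OF z subs(2)] by (simp_all add: e f bB' bN')
    ultimately show ?thesis
      unfolding dim all_less_add_iff
      by (simp only: all_pick_iff[OF fin(1), symmetric] all_pick_iff[OF fin(2), symmetric] cong: all_cong)
  qed
  \<comment> \<open>The gap \<open>f - R e\<close> is \<open>R\<^sup>2 w\<close> on \<open>B\<close>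
    and \<open>R\<^sup>2 z\<close> on \<open>N\<close>, both strictly positive there.\<close>
  have below: "\<forall>i<dim_vec e. R * e $ i < f $ i"
    unfolding entries[where P = "\<lambda>x y. R * x < y"] using R by (auto simp: B N algebra_simps)
  have ge_iff: "maintained A b c B N p R w y z R' \<longleftrightarrow> ereal R' \<le> R\<^sub>n" if "R' \<ge> R" for R'
    unfolding Rn ratio_min_ge_iff[of e R f, OF below R that] maintained_iff optimal_iff[OF that]
      entries[where P = "\<lambda>x y. R' * x \<le> y"] ..
  have R_le: "ereal R \<le> R\<^sub>n"
    unfolding Rn ratio_min_ge_iff[of e R f, OF below R order.refl] using below less_imp_le by blast
  have "optimal_triplet A ((1 / real_of_ereal R\<^sub>n) \<cdot>\<^sub>v b) c (?w (real_of_ereal R\<^sub>n))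
      (?y (real_of_ereal R\<^sub>n)) (?z (real_of_ereal R\<^sub>n))" if "R\<^sub>n < \<infinity>"
  proof -
    \<comment> \<open>The ratio test is a nonstrict inequality, so a finite \<open>R\<^sub>n\<close>
      is itself an admissible parameter.\<close>
    obtain r where r: "R\<^sub>n = ereal r" using R_le \<open>R\<^sub>n < \<infinity>\<close> by (cases R\<^sub>n) auto
    then show ?thesis using R_le ge_iff[of r] maintained_iff[of r] by simp
  qed
  moreover have "lp_optimal A b c (R \<cdot>\<^sub>v w)" if "R\<^sub>n = \<infinity>"
  proof -
    let ?w' = "w + Matrix.vec n (\<lambda>i. if i \<in> B then - (1 / R) * q $ i else 0)"
      and ?z' = "z + Matrix.vec n (\<lambda>i. if i \<in> N then 1 / R * q $ i else 0)"
    have "ratio_min e f = \<infinity>" using that Rn by (rule back_subst[of "\<lambda>r. r = \<infinity>"])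
    then have "\<forall>i<dim_vec e. e $ i \<le> 0" using ratio_min_eq_infinity[OF below R] by simp
    \<comment> \<open>Divided by \<open>R\<close>, the condition \<open>e \<le> 0\<close> is the
      sign condition for the step \<open>t = 1 / R\<close>, at which the right-hand side becomes
      zero.\<close>
    then have "(\<forall>i\<in>B. q $ i \<le> R * w $ i) \<and> (\<forall>i\<in>N. - q $ i \<le> R * z $ i)"
      unfolding entries[where P = "\<lambda>x y. x \<le> 0"] by auto
    then have "(\<forall>i\<in>B. 1 / R * q $ i \<le> w $ i) \<and> (\<forall>i\<in>N. - (1 / R * q $ i) \<le> z $ i)"
      using R by (simp add: field_simps)
    then have "optimal_triplet A ((1 / R) \<cdot>\<^sub>v b - (1 / R) \<cdot>\<^sub>v b) c ?w' (y + (- (1 / R)) \<cdot>\<^sub>v p) ?z'"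
      unfolding path[of "1 / R"] .
    moreover have "(1 / R) \<cdot>\<^sub>v b - (1 / R) \<cdot>\<^sub>v b = 0\<^sub>v m" using d by auto
    ultimately have limit: "optimal_triplet A (0\<^sub>v m) c ?w' (y + (- (1 / R)) \<cdot>\<^sub>v p) ?z'" by simp
    have "A *\<^sub>v (R \<cdot>\<^sub>v w) = b" using R b by (simp add: mult_mat_vec[OF A w] Aw smult_smult_assoc)
    moreover have "\<forall>i<n. 0 \<le> (R \<cdot>\<^sub>v w) $ i" using R sign by (simp add: carrier_vecD[OF w])
    ultimately have "R \<cdot>\<^sub>v w \<in> lp_feasible A b"
      unfolding lp_feasible_iff[OF A] using w by simp
    \<comment> \<open>\<open>?z'\<close> is supported on \<open>N\<close>, where \<open>w\<close>
      vanishes by complementarity.\<close>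
    moreover have "?z' \<bullet> (R \<cdot>\<^sub>v w) = 0"
      unfolding scalar_prod_def using sign w z by (intro sum.neutral) (force simp: N)
    ultimately show ?thesis
      by (rule lp_optimal_of_homogeneous_triplet[OF A c finite_value limit])
  qed
  ultimately show ?thesis using R_le ge_iff by blast
qed

end
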